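(* The poset $P=2^{<\omega}\mathbin{\dot\cup}[0,1]$ (with the binary-expansion order defined in the context) is well-founded.
   Context: Let $T=2^{<\omega}$ be the set of finite binary words with the prefix order $\preccurlyeq$, and $X=2^\omega$ the set of infinite binary sequences. For $s\in T$, $[s]=\{\alpha\in X: s \text{ is a prefix of }\alpha\}$. Let $\pi:X\to[0,1]$, $\pi(\alpha)=\sum_{n=0}^\infty \alpha(n)/2^{n+1}$. The poset $P=T\mathbin{\dot\cup}[0,1]$ (disjoint union) is ordered by: for $s,t\in T$, $s\le t$ iff $s\preccurlyeq t$; for $s\in T$, $r\in[0,1]$, $s\le r$ iff $r\in\pi([s])$; for $r,q\in[0,1]$, $r\le q$ iff $r=q$; no other comparabilities. A poset is well-founded if it has no infinite strictly descending chain. *)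

theory Defs
  imports "HOL-Analysis.Analysis" "HOL-Library.Sublist"
begin

text \<open>Binary digits are booleans (\<open>True\<close> is the digit 1), so finite words are of type
  \<^typ>\<open>bool list\<close> and infinite sequences of type \<^typ>\<open>nat \<Rightarrow> bool\<close>.\<close>

definition cylinder :: "bool list \<Rightarrow> (nat \<Rightarrow> bool) set" where
  "cylinder s = {\<alpha>. \<forall>i<length s. \<alpha> i = s ! i}"

definition bin_val :: "(nat \<Rightarrow> bool) \<Rightarrow> real" where
  "bin_val \<alpha> = (\<Sum>n. of_bool (\<alpha> n) / 2 ^ (n + 1))"

definition P_carrier :: "(bool list + real) set" where
  "P_carrier = UNIV <+> {0..1}"

fun P_le :: "bool list + real \<Rightarrow> bool list + real \<Rightarrow> bool" where
  "P_le (Inl s) (Inl t) \<longleftrightarrow> prefix s t"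
| "P_le (Inl s) (Inr r) \<longleftrightarrow> r \<in> bin_val ` cylinder s"
| "P_le (Inr r) (Inl s) \<longleftrightarrow> False"
| "P_le (Inr r) (Inr q) \<longleftrightarrow> r = q"

definition P_order :: "(bool list + real) rel" where
  "P_order = {(x, y). x \<in> P_carrier \<and> y \<in> P_carrier \<and> P_le x y}"

lemma cylinder_antimono: "prefix s t \<Longrightarrow> cylinder t \<subseteq> cylinder s"
  by (auto simp: cylinder_def prefix_def nth_append)

lemma partial_order_P: "partial_order_on P_carrier P_order"
proof -
  have refl: "P_le x x" for x
    by (cases x) auto
  have trans: "P_le x z" if "P_le x y" "P_le y z" for x y z
    using that
    by (cases x; cases y; cases z) (auto dest: cylinder_antimono prefix_order.trans)
  have antisym: "x = y" if "P_le x y" "P_le y x" for x y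
    using that by (cases x; cases y) auto
  show ?thesis
    unfolding partial_order_on_def preorder_on_def refl_on_def trans_def antisym_def P_order_def
    using refl trans antisym by blast
qed

text \<open>For a poset given by its carrier \<open>A\<close> and its (reflexive) order relation \<open>r\<close>:
  \<open>(x, y) \<in> r\<close> means \<open>x \<le> y\<close>, and the strict order is \<open>r - Id\<close>.\<close>

definition well_founded_poset :: "'a set \<Rightarrow> 'a rel \<Rightarrow> bool" where
  "well_founded_poset A r \<longleftrightarrow>
    \<not> (\<exists>f :: nat \<Rightarrow> 'a. (\<forall>i. f i \<in> A) \<and> (\<forall>i. (f (Suc i), f i) \<in> r - Id))"

end

theory Submission
  imports Defs
begin

text \<open>Rank words by length and put all reals on one level above every word, in effect a height
  in omega + 1. \<open>P_rank_less\<close> shows that this height drops along each strict descent,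
  so the strict order inherits well-foundedness from the lexicographic order.\<close>

fun P_rank :: "bool list + real \<Rightarrow> nat \<times> nat" where
  "P_rank (Inl s) = (0, length s)"
| "P_rank (Inr r) = (1, 0)"

text \<open>A proper prefix is shorter, no real lies below a word, and distinct reals are
  incomparable, so one common rank for all reals is enough.\<close>

lemma P_rank_less:
  assumes "P_le x y" "x \<noteq> y"
  shows "(P_rank x, P_rank y) \<in> less_than <*lex*> less_than"
  using assms by (cases x; cases y) (auto simp: prefix_length_less strict_prefix_def)

lemma wf_P_order: "wf (P_order - Id)"
proof (rule wf_subset)
  show "wf (inv_image (less_than <*lex*> less_than) P_rank)"
    by (intro wf_inv_image wf_lex_prod wf_less_than)
  show "P_order - Id \<subseteq> inv_image (less_than <*lex*> less_than) P_rank"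
    by (auto simp: P_order_def inv_image_def simp del: in_lex_prod intro: P_rank_less)
qed

theorem proposition3p4:
  shows "well_founded_poset P_carrier P_order"
  using wf_P_order unfolding well_founded_poset_def wf_iff_no_infinite_down_chain by blast

end
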